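(* Let $d\ge 1$ be an integer, $r=\lfloor\frac{d+1}2\rfloor$, and for $n\ge0$ let $$A_n=A_n^{(d)}=\sum_{n_1+\dots+n_d=n}\frac{(2n)!}{(n_1!)^2\cdots(n_d!)^2}$$ (sum over nonnegative integers). There are polynomials $Q_0^A,\dots,Q_r^A$ such that the sequence $(A_n)_n$ satisfies, for all $n\ge0$, the recurrence $$\sum_{k=0}^rQ_k^A(n+k)\,A_{n+k}=0$$ and the initial conditions $$\sum_{k=0}^mQ^A_{r-m+k}(k)\,A_k=0\quad\text{for }0\le m\le r-1,$$ and moreover: 1. $\deg(Q_k^A)=d$ for all $0\le k\le r$. 2. $Q_k^A(-n-r+k)=(-1)^{d}Q_k^A(n)$ for all $0\le k\le r$. 3. The leading coefficient of $Q_k^A(n)$ is $(-1)^{r-k}e_{r-k}(S_d^A)$. 4. $Q_r^A(n)=n^{d}$. 5. For $0\le k\le r-1$, $\prod_{j=1}^{r-k}(2n+2j-1)\prod_{j=1}^{r-k-1}(n+j)$ divides $Q_k^A(n)$. 6. If $d$ is odd, then $Q_0^A(n)=(-1)^re_r(S_d^A)\prod_{j=1}^{r}(n+j-\tfrac12)\prod_{j=1}^{r-1}(n+j)$. If $d$ is even, then $Q_0^A(n)=(-1)^re_r(S_d^A)\,(n+\tfrac r2)\prod_{j=1}^{r}(n+j-\tfrac12)\prod_{j=1}^{r-1}(n+j)$. 7. $Q_{r-1}^A(n)=-2(2n+1)\sum_{j=0}^{d-1}(d-j)\binom{d+2}{j}n^j=-2(2n+1)\left[(n+1)^{d+1}(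d-2n)+n^{d+1}(d+2+2n)\right]$.
   Context: $S_d^A=\{4k^2:\ 1\le k\le d,\ k\equiv d\pmod 2\}$, and $e_m(S_d^A)$ denotes the $m$-th elementary symmetric sum of its elements (with $e_0=1$). Divisibility is in the polynomial ring. *)

theory Defs
  imports "HOL-Computational_Algebra.Computational_Algebra"
begin

(* natpermute n d is the set of all lists of d natural numbers with sum n *)
definition A_seq :: "nat \<Rightarrow> nat \<Rightarrow> rat" where
  "A_seq d n = (\<Sum>ns\<in>natpermute n d. fact (2 * n) / (\<Prod>i<d. (fact (ns ! i))\<^sup>2))"

definition S_A :: "nat \<Rightarrow> nat set" where
  "S_A d = {4 * k\<^sup>2 | k. 1 \<le> k \<and> k \<le> d \<and> k mod 2 = d mod 2}"

definition elem_sym :: "nat \<Rightarrow> 'a::comm_semiring_1 set \<Rightarrow> 'a" where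
  "elem_sym m S = (\<Sum>X | X \<subseteq> S \<and> card X = m. \<Prod>x\<in>X. x)"

text \<open>
  The definition is only meaningful for a finite set: the sum then ranges over a finite
  collection of finite subsets. This covers the sets used here.
\<close>

lemma finite_S_A: "finite (S_A d)"
proof -
  have "S_A d \<subseteq> (\<lambda>k. 4 * k\<^sup>2) ` {1..d}"
    by (auto simp: S_A_def)
  thus ?thesis
    by (rule finite_subset) simp
qed

lemma elem_sym_0: "finite S \<Longrightarrow> elem_sym 0 S = 1"
proof -
  assume S: "finite S"
  have "{X. X \<subseteq> S \<and> card X = 0} = {{}}"
    using S by (auto dest: finite_subset)
  thus ?thesis
    by (simp add: elem_sym_def)
qed

end

theory Submission
  imports Defs
begin

text \<open>
  Write \<open>\<theta> = t d/dt\<close> and let \<open>f = \<Sum> t^n / (n!)^2\<close> be the Bessel series, so that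
  \<open>\<theta>\<theta>f = t f\<close>. The multinomial sum defining \<open>A_n\<close> is a Cauchy product:
  \<open>A_n / (2n)!\<close> is the coefficient of \<open>t^n\<close> in \<open>f^d\<close>. Hence a differential equation for
  \<open>f^d\<close> is a recurrence for \<open>A_n\<close>.

  Differentiating the products \<open>f^(d-k) (\<theta>f)^k\<close> shows that the operators \<open>L_0 = 1\<close>,
  \<open>L_1 = \<theta>\<close>, \<open>L_(k+1) = \<theta> L_k - k (d+1-k) t L_(k-1)\<close> send \<open>f^d\<close> to multiples of these
  products, and that \<open>L_(d+1)\<close> annihilates \<open>f^d\<close> (\<open>op_cont_annihilates_power\<close>). Expand
  \<open>L_(d+1) = \<Sum> t^j P_j(\<theta>)\<close>. Comparing coefficients of \<open>t^n\<close>, clearing the factorials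
  \<open>(2n)!/(2n-2j)!\<close> and cancelling one factor \<open>n\<close> gives the recurrence with
  \<open>Q_(r-j)(x) = 2^j (2x+1)(2x+3)...(2x+2j-1) (x+1)...(x+j-1) P_j(x)\<close> for \<open>j > 0\<close> and
  \<open>Q_r(x) = x^d\<close>. The coefficients of \<open>t^n\<close> with \<open>n < r\<close> are the initial conditions, and the
  divisibility is visible in the formula. The other claims are facts about the \<open>P_j\<close>.

  \<^item> Symmetry: \<open>L_(d+1)\<close> is a noncommutative continuant whose weights \<open>k (d+1-k)\<close> read the
    same from both ends. The antiautomorphism fixing \<open>t\<close> and negating \<open>\<theta>\<close> reverses words, so
    it multiplies \<open>L_(d+1)\<close> by \<open>(-1)^(d+1)\<close>; it sends \<open>t^j P_j(\<theta>)\<close> to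
    \<open>t^j P_j(-\<theta>-j)\<close> (\<open>op_cont_reverse\<close>).

  \<^item> Leading coefficients: in top degree \<open>\<theta>\<close> and \<open>t\<close> commute, so the leading coefficients of
    the \<open>P_j\<close> are the coefficients of the commutative continuant with the same weights. This
    is the characteristic polynomial of the Sylvester-Kac matrix, whose roots are
    \<open>d, d-2, ..., -d\<close> (\<open>cont_kac_root\<close>); pairing opposite roots gives \<open>\<Prod> (X^2 - k^2)\<close> and
    with it the elementary symmetric sums.

  \<^item> \<open>Q_0\<close>: the polynomial \<open>P_r\<close> has degree 0 or 1, so its leading coefficient and its symmetry
    determine it.

  \<^item> \<open>Q_(r-1)\<close>: the polynomial \<open>P_1\<close> collects the words with a single letter \<open>t\<close>, which gives
    an explicit sum that is evaluated in closed form.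
\<close>

section \<open>Continuants over the Weyl algebra\<close>

text \<open>
  The operators \<open>L_(k+2) = \<theta> L_(k+1) + w_(k+1) t L_k\<close> are written in normal form
  \<open>L_k = \<Sum> t^j P_j(\<theta>)\<close>, with all \<open>t\<close> on the left; \<open>op_cont w k j\<close> is \<open>P_j\<close>. The factor
  \<open>[:j, 1:]\<close> comes from \<open>\<theta> t^j = t^j (\<theta> + j)\<close>.
\<close>

fun op_cont :: "(nat \<Rightarrow> 'a::comm_ring_1) \<Rightarrow> nat \<Rightarrow> nat \<Rightarrow> 'a poly" where
  "op_cont w 0 j = (if j = 0 then 1 else 0)"
| "op_cont w (Suc 0) j = (if j = 0 then [:0, 1:] else 0)"
| "op_cont w (Suc (Suc k)) j = [:of_nat j, 1:] * op_cont w (Suc k) j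
     + (case j of 0 \<Rightarrow> 0 | Suc i \<Rightarrow> smult (w (Suc k)) (op_cont w k i))"

lemma op_cont_0: "op_cont w k 0 = monom 1 k"
  by (induction k rule: induct_nat_012) (simp_all add: monom_Suc monom_0)

lemma op_cont_eq_0: "k < 2 * j \<Longrightarrow> op_cont w k j = 0"
proof (induction w k j rule: op_cont.induct)
  case (3 w k j)
  then show ?case by (cases j) auto
qed auto

lemma degree_op_cont: "degree (op_cont w k j) \<le> k - 2 * j"
proof (induction w k j rule: op_cont.induct)
  case (3 w k j)
  show ?case
  proof (cases "Suc (Suc k) < 2 * j")
    case True
    then show ?thesis by (simp only: op_cont_eq_0 degree_0)
  next
    case False
    have "degree ([:of_nat j, 1:] * op_cont w (Suc k) j) \<le> Suc (Suc k) - 2 * j"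
    proof (cases "Suc k < 2 * j")
      case True
      then show ?thesis by (simp only: op_cont_eq_0 mult_zero_right degree_0)
    next
      case False
      have "degree ([:of_nat j, 1:] * op_cont w (Suc k) j)
          \<le> degree [:of_nat j, 1 :: 'a:] + degree (op_cont w (Suc k) j)"
        by (rule degree_mult_le)
      then show ?thesis using 3(1) False by simp
    qed
    moreover have "degree (smult (w (Suc k)) (op_cont w k i)) \<le> Suc (Suc k) - 2 * j"
      if "j = Suc i" for i
      using 3(2)[OF that] that degree_smult_le[of "w (Suc k)" "op_cont w k i"] by simp
    ultimately show ?thesis
      by (auto split: nat.split intro: degree_add_le)
  qed
qed auto

text \<open>
  A word with a single \<open>t\<close> has the form \<open>\<theta>^(k-1-i) t \<theta>^i = t (\<theta>+1)^(k-1-i) \<theta>^i\<close>.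
\<close>

lemma poly_op_cont_1:
  "poly (op_cont w (Suc k) 1) x = (\<Sum>i<k. w (Suc i) * x ^ i * (x + 1) ^ (k - 1 - i))"
proof (induction k)
  case (Suc k)
  have "poly (op_cont w (Suc (Suc k)) 1) x
      = (x + 1) * poly (op_cont w (Suc k) 1) x + w (Suc k) * x ^ k"
    by (simp add: op_cont_0 poly_monom algebra_simps)
  also have "\<dots> = (\<Sum>i<k. w (Suc i) * x ^ i * (x + 1) ^ (k - i)) + w (Suc k) * x ^ k"
  proof -
    have "(x + 1) ^ (k - i) = (x + 1) * (x + 1) ^ (k - 1 - i)" if "i < k" for i
    proof -
      have "k - i = Suc (k - 1 - i)" using that by simp
      then show ?thesis by (simp only: power_Suc)
    qed
    then show ?thesis
      unfolding Suc sum_distrib_left by (simp add: mult_ac)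
  qed
  finally show ?case by simp
qed simp

lemma op_cont_back:
  "poly (op_cont w (Suc (Suc k)) j) x
     = (x + of_nat j) * poly (op_cont w (Suc k) j) x
       + (case j of 0 \<Rightarrow> 0 | Suc i \<Rightarrow> w (Suc k) * poly (op_cont w k i) x)"
  unfolding op_cont.simps(3) by (simp del: op_cont.simps split: nat.split add: algebra_simps)

text \<open>
  A continuant can also be expanded at its first letters,
  \<open>L_(k+2) = L'_(k+1) \<theta> + w_1 L''_k t\<close>, where primes shift the weights. Moving the last \<open>t\<close> to the
  left replaces \<open>P(\<theta>) t\<close> by \<open>t P(\<theta>+1)\<close>, whence the evaluation at \<open>x + 1\<close>. In the
  induction step, expanding a word at both ends gives the same four terms in either order.
\<close>

lemma op_cont_front:
  "poly (op_cont w (Suc (Suc k)) j) x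
     = x * poly (op_cont (\<lambda>i. w (Suc i)) (Suc k) j) x
       + (case j of 0 \<Rightarrow> 0
          | Suc i \<Rightarrow> w 1 * poly (op_cont (\<lambda>i. w (Suc (Suc i))) k i) (x + 1))"
proof (induction k arbitrary: j rule: less_induct)
  case (less k)
  consider "k = 0" | "k = 1" | l where "k = Suc (Suc l)"
    by (metis One_nat_def not0_implies_Suc)
  then show ?case
  proof cases
    case 1
    then show ?thesis by (auto split: nat.split simp: algebra_simps)
  next
    case 2
    then show ?thesis by (auto split: nat.split simp: algebra_simps)
  next
    case 3
    show ?thesis
    proof (cases j)
      case 0
      then show ?thesis by (simp add: op_cont_0 poly_monom del: op_cont.simps)
    next
      case (Suc i)
      note unfold_w = op_cont_back[of w "Suc (Suc l)" "Suc i" x]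
        less[of "Suc l" "Suc i", unfolded 3, simplified nat.case]
        less[of l i, unfolded 3]
      note unfold_shifted = op_cont_back[of "\<lambda>n. w (Suc n)" "Suc l" "Suc i" x]
        op_cont_back[of "\<lambda>n. w (Suc (Suc n))" l i "x + 1"]
      show ?thesis
        unfolding 3 Suc nat.case unfold_shifted
        by (simp del: op_cont.simps add: unfold_w split: nat.split) (simp add: algebra_simps del: op_cont.simps)
    qed
  qed
qed

text \<open>
  The antiautomorphism \<open>\<theta> \<mapsto> -\<theta>\<close>, \<open>t \<mapsto> t\<close> exists because \<open>\<theta> t - t \<theta> = t\<close> is preserved. It
  exchanges the expansion at the last letters with the expansion at the first letters, so it
  reverses the list of weights. The sign counts the letters \<open>\<theta>\<close> modulo 2: each factor \<open>t\<close>
  replaces two of them.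
\<close>

lemma op_cont_reverse:
  "poly (op_cont w k j) (- x - of_nat j)
     = (- 1) ^ k * poly (op_cont (\<lambda>i. w (k - i)) k j) x"
proof (induction w k j arbitrary: x rule: op_cont.induct)
  case (3 w k j)
  have "poly (op_cont w (Suc (Suc k)) j) (- x - of_nat j)
      = - x * poly (op_cont w (Suc k) j) (- x - of_nat j)
        + (case j of 0 \<Rightarrow> 0
           | Suc i \<Rightarrow> w (Suc k) * poly (op_cont w k i) (- (x + 1) - of_nat i))"
  proof (cases j)
    case (Suc i)
    have "- x - of_nat j = - (x + 1) - of_nat i" by (simp add: Suc)
    then show ?thesis unfolding op_cont_back by (simp add: Suc diff_diff_eq)
  qed simp
  also have "\<dots> = - x * ((- 1) ^ Suc k * poly (op_cont (\<lambda>i. w (Suc k - i)) (Suc k) j) x)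
        + (case j of 0 \<Rightarrow> 0
           | Suc i \<Rightarrow> w (Suc k) * ((- 1) ^ k * poly (op_cont (\<lambda>i. w (k - i)) k i) (x + 1)))"
  proof (cases j)
    case 0
    then show ?thesis using 3(1)[of x] by (simp only: nat.case)
  next
    case (Suc i)
    show ?thesis
      using 3(1)[of x] 3(2)[OF Suc, of "x + 1"] by (simp only: Suc nat.case)
  qed
  also have "\<dots> = (- 1) ^ Suc (Suc k)
      * poly (op_cont (\<lambda>i. w (Suc (Suc k) - i)) (Suc (Suc k)) j) x"
    by (subst op_cont_front) (simp split: nat.split add: algebra_simps)
  finally show ?case .
qed auto

definition theta :: "'a::comm_ring_1 fps \<Rightarrow> 'a fps" where
  "theta F = fps_X * fps_deriv F"

lemma fps_nth_theta: "fps_nth (theta F) n = of_nat n * fps_nth F n"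
  by (cases n) (simp_all add: theta_def)

text \<open>
  The link between normal forms and series: \<open>t^j P(\<theta>)\<close> contributes
  \<open>P(n - j)\<close> times the coefficient of index \<open>n - j\<close> to the coefficient of index \<open>n\<close>.
\<close>

lemma op_cont_action:
  assumes G1: "G 1 = theta (G 0)"
    and G2: "\<And>k. G (Suc (Suc k)) = theta (G (Suc k)) + fps_const (w (Suc k)) * fps_X * G k"
  shows "fps_nth (G k) n
    = (\<Sum>j\<le>n. poly (op_cont w k j) (of_nat (n - j)) * fps_nth (G 0) (n - j))"
proof (induction k arbitrary: n rule: induct_nat_012)
  case 0
  show ?case by (subst sum.remove[of _ 0]) auto
next
  case 1
  show ?case by (subst sum.remove[of _ 0]) (auto simp: G1[simplified] fps_nth_theta)
next
  case (ge2 k)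
  let ?a = "fps_nth (G 0)"
  have shift: "(\<Sum>j\<le>n. (case j of 0 \<Rightarrow> 0
        | Suc i \<Rightarrow> w (Suc k) * poly (op_cont w k i) (of_nat (n - j))) * ?a (n - j))
      = fps_nth (fps_const (w (Suc k)) * fps_X * G k) n"
  proof (cases n)
    case (Suc m)
    show ?thesis
      unfolding Suc sum.atMost_Suc_shift
      by (simp add: ge2(1) mult.assoc sum_distrib_left)
  qed (simp add: mult.assoc)
  have "fps_nth (theta (G (Suc k))) n
      = (\<Sum>j\<le>n. (of_nat j + of_nat (n - j)) * poly (op_cont w (Suc k) j) (of_nat (n - j))
           * ?a (n - j))"
    unfolding fps_nth_theta ge2(2) sum_distrib_left
    by (intro sum.cong refl) (auto simp: mult.assoc simp flip: of_nat_add)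
  then show ?case
    unfolding G2 fps_add_nth shift[symmetric]
    by (simp add: sum.distrib[symmetric] algebra_simps split: nat.split)
       (intro sum.cong refl, auto split: nat.split simp: algebra_simps)
qed

section \<open>The differential equation of a power of the Bessel series\<close>

text \<open>
  The truncated subtraction makes the weight vanish beyond \<open>d + 1\<close>. Hence the recursion of the
  products \<open>f^(d-k) (\<theta>f)^k\<close> and the reversal \<open>i \<mapsto> d + 1 - i\<close> hold for all indices, without
  bounds.
\<close>

definition kac_weight :: "nat \<Rightarrow> nat \<Rightarrow> 'a::comm_ring_1" where
  "kac_weight d i = - of_nat (i * (d + 1 - i))"

lemma theta_mult: "theta (F * G) = theta F * G + F * theta G"
  by (simp add: theta_def algebra_simps)

lemma theta_power: "theta (F ^ n) = of_nat n * theta F * F ^ (n - 1)"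
  by (simp add: theta_def fps_deriv_power' algebra_simps)

lemma theta_of_nat [simp]: "theta (of_nat c) = 0"
  by (simp add: theta_def)

text \<open>
  The \<open>d\<close>-th symmetric power of the equation \<open>\<theta>\<theta>f = t f\<close>. With \<open>c_k = d (d-1) ... (d-k+1)\<close>,
  the product rule gives
  \<open>\<theta> (f^(d-k) (\<theta>f)^k) = (d-k) f^(d-k-1) (\<theta>f)^(k+1) + k t f^(d-k+1) (\<theta>f)^(k-1)\<close>, so that
  \<open>c_k f^(d-k) (\<theta>f)^k\<close> satisfies the recursion of the operators \<open>L_k\<close> applied to \<open>f^d\<close>. The
  sequence stops because \<open>c_(d+1) = 0\<close>.
\<close>

lemma op_cont_annihilates_power:
  fixes f :: "'a::comm_ring_1 fps"
  assumes f: "theta (theta f) = fps_X * f"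
  shows "(\<Sum>j\<le>n. poly (op_cont (kac_weight d) (d + 1) j) (of_nat (n - j))
           * fps_nth (f ^ d) (n - j)) = 0"
proof -
  define c where "c k = (\<Prod>i<k. d - i)" for k
  define G where "G k = of_nat (c k) * f ^ (d - k) * theta f ^ k" for k
  have c_Suc: "c (Suc k) = c k * (d - k)" for k
    by (simp add: c_def)
  have c_0: "c k = 0" if "d < k" for k
    using that by (auto simp: c_def)
  have "G 1 = theta (G 0)"
    by (simp add: G_def c_def theta_power algebra_simps)
  moreover have "G (Suc (Suc k))
      = theta (G (Suc k)) + fps_const (kac_weight d (Suc k)) * fps_X * G k" for k
  proof (cases "k < d")
    case True
    then obtain m where d: "d = k + Suc m"
      by (metis less_iff_Suc_add add_Suc_right)
    have kac: "fps_const (kac_weight d (Suc k) :: 'a) = - of_nat (Suc k * Suc m)"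
      by (simp add: d kac_weight_def flip: fps_const_neg fps_of_nat del: of_nat_mult of_nat_Suc)
    have "theta (G (Suc k)) = of_nat (c (Suc k))
        * (of_nat m * theta f * f ^ (m - 1) * theta f ^ Suc k
           + f ^ m * (of_nat (Suc k) * (fps_X * f) * theta f ^ k))"
      by (simp add: G_def d theta_mult theta_power f distrib_left mult.assoc del: power_Suc of_nat_Suc)
    then show ?thesis
      unfolding kac
      by (simp add: G_def c_Suc d algebra_simps)
  next
    case False
    then show ?thesis
      by (simp add: G_def c_0 kac_weight_def theta_def)
  qed
  ultimately have "fps_nth (G (d + 1)) n
      = (\<Sum>j\<le>n. poly (op_cont (kac_weight d) (d + 1) j) (of_nat (n - j))
           * fps_nth (G 0) (n - j))"
    by (rule op_cont_action)
  then show ?thesis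
    by (simp add: G_def c_0 c_def)
qed

definition bessel_fps :: "rat fps" where
  "bessel_fps = Abs_fps (\<lambda>n. 1 / (fact n)\<^sup>2)"

lemma theta_theta_bessel: "theta (theta bessel_fps) = fps_X * bessel_fps"
proof (rule fps_ext)
  fix n show "fps_nth (theta (theta bessel_fps)) n = fps_nth (fps_X * bessel_fps) n"
    by (cases n)
       (simp_all add: fps_nth_theta bessel_fps_def divide_simps power2_eq_square del: of_nat_Suc)
qed

lemma A_seq_eq_bessel_power:
  assumes "d \<ge> 1"
  shows "A_seq d n = fact (2 * n) * fps_nth (bessel_fps ^ d) n"
proof -
  have "{0..d - 1} = {..<d}"
    using assms by auto
  then show ?thesis
    using assms
    by (simp add: A_seq_def fps_power_nth bessel_fps_def sum_distrib_left prod_dividef)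
qed

section \<open>Leading coefficients: the Sylvester-Kac continuant\<close>

text \<open>
  The commutative shadow of \<open>op_cont\<close>: \<open>\<theta>\<close> becomes the variable and \<open>t\<close> becomes 1. It records
  the top coefficients of all the \<open>P_j\<close> at once, since \<open>P_j\<close> contributes in degree \<open>k - 2j\<close>.
\<close>

fun cont :: "(nat \<Rightarrow> 'a::comm_ring_1) \<Rightarrow> nat \<Rightarrow> 'a poly" where
  "cont w 0 = 1"
| "cont w (Suc 0) = [:0, 1:]"
| "cont w (Suc (Suc k)) = pCons 0 (cont w (Suc k)) + smult (w (Suc k)) (cont w k)"

lemma cont_monic:
  fixes w :: "nat \<Rightarrow> 'a::comm_ring_1"
  shows "degree (cont w k) \<le> k \<and> coeff (cont w k) k = 1"
proof (induction k rule: induct_nat_012)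
  case (ge2 k)
  have "degree (pCons 0 (cont w (Suc k))) \<le> Suc (Suc k)"
    using ge2(2) degree_pCons_le[of 0 "cont w (Suc k)"] by linarith
  moreover have "degree (smult (w (Suc k)) (cont w k)) \<le> Suc (Suc k)"
    using ge2(1) degree_smult_le[of "w (Suc k)" "cont w k"] by linarith
  moreover have "coeff (cont w k) (Suc (Suc k)) = 0"
    using ge2(1) by (intro coeff_eq_0) simp
  ultimately show ?case
    using ge2 by (auto intro: degree_add_le)
qed simp_all

text \<open>
  The correction \<open>j\<close> in \<open>\<theta> t^j = t^j (\<theta> + j)\<close> multiplies a polynomial of too small a degree to
  reach the top coefficient.
\<close>

lemma coeff_op_cont_top:
  "2 * j \<le> k \<Longrightarrow> coeff (op_cont w k j) (k - 2 * j) = coeff (cont w k) (k - 2 * j)"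
proof (induction w k j rule: op_cont.induct)
  case (3 w k j)
  have first: "coeff ([:of_nat j, 1:] * op_cont w (Suc k) j) (Suc (Suc k) - 2 * j)
      = coeff (pCons 0 (cont w (Suc k))) (Suc (Suc k) - 2 * j)"
  proof (cases "2 * j \<le> Suc k")
    case True
    then have m: "Suc (Suc k) - 2 * j = Suc (Suc k - 2 * j)" by simp
    have "coeff (op_cont w (Suc k) j) (Suc (Suc k - 2 * j)) = 0"
      using degree_op_cont[of w "Suc k" j] by (intro coeff_eq_0) simp
    then show ?thesis using 3(1) True by (simp add: m)
  next
    case False
    then have "Suc (Suc k) - 2 * j = 0" "op_cont w (Suc k) j = 0"
      by (simp_all only: op_cont_eq_0)
    then show ?thesis by simp
  qed
  show ?case
  proof (cases j)
    case 0
    have "coeff (cont w k) (Suc (Suc k)) = 0"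
      using cont_monic[of w k] by (intro coeff_eq_0) simp
    then show ?thesis using first 0 by simp
  next
    case (Suc i)
    then show ?thesis using first 3(2)[OF Suc] 3(3) by simp
  qed
qed auto

lemma degree_kac_series:
  assumes "i \<le> d"
  shows "degree ([:1, 1 :: 'a::comm_ring_1:] ^ (d - i) * [:1, -1:] ^ i) \<le> d"
proof -
  have "degree ([:1, 1 :: 'a:] ^ (d - i) * [:1, -1:] ^ i)
      \<le> degree ([:1, 1 :: 'a:] ^ (d - i)) + degree ([:1, -1 :: 'a:] ^ i)"
    by (rule degree_mult_le)
  also have "\<dots> \<le> (d - i) + i"
    using degree_power_le[of "[:1, 1 :: 'a:]" "d - i"] degree_power_le[of "[:1, -1 :: 'a:]" i]
    by (intro add_mono) auto
  finally show ?thesis using assms by simp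
qed

text \<open>
  For fixed \<open>\<lambda>\<close>, the recursion of the values \<open>C_k(\<lambda>)\<close> of these continuants says that
  \<open>y = \<Sum> C_k(\<lambda>) z^k / k!\<close> solves \<open>(1 - z^2) y' = (\<lambda> - d z) y\<close>, hence
  \<open>y = (1 + z)^((d+\<lambda>)/2) (1 - z)^((d-\<lambda>)/2)\<close>. At \<open>\<lambda> = d - 2i\<close> this is the polynomial
  \<open>(1 + z)^(d-i) (1 - z)^i\<close>. The truncation of the weights beyond \<open>d + 1\<close> is harmless, because
  there the coefficients of \<open>y\<close> vanish.
\<close>

lemma poly_cont_kac:
  fixes d i k :: nat
  assumes "i \<le> d"
  shows "poly (cont (kac_weight d) k) (of_nat d - 2 * of_nat i :: 'a::{idom,ring_char_0})
     = fact k * coeff ([:1, 1:] ^ (d - i) * [:1, -1:] ^ i) k"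
    (is "poly _ ?l = _ * coeff ?y _")
proof -
  have deg: "degree ?y \<le> d" using assms by (rule degree_kac_series)
  have ode: "[:1, 0, -1:] * pderiv ?y = [:?l, - of_nat d:] * ?y"
  proof -
    obtain m where m: "d = i + m" using assms le_Suc_ex by blast
    have log_deriv: "q * pderiv (q ^ n) = of_nat n * pderiv q * q ^ n" for q :: "'a poly" and n
      by (cases n) (simp_all only: pderiv_power_Suc, simp_all add: of_nat_poly mult_ac)
    have "pderiv [:1, 1 :: 'a:] = 1" "pderiv [:1, -1 :: 'a:] = - 1"
      by (simp_all add: pderiv_pCons one_pCons)
    then have p: "[:1, 1:] * pderiv ([:1, 1 :: 'a:] ^ m) = of_nat m * [:1, 1:] ^ m"
      and q: "[:1, -1:] * pderiv ([:1, -1 :: 'a:] ^ i) = - of_nat i * [:1, -1:] ^ i"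
      by (simp_all only: log_deriv mult_1_right mult_minus_right)
    have "[:1, 0, -1:] = [:1, 1:] * [:1, -1 :: 'a:]" by simp
    then have "[:1, 0, -1:] * pderiv ?y
        = [:1, -1:] ^ Suc i * ([:1, 1:] * pderiv ([:1, 1:] ^ m))
          + [:1, 1:] ^ Suc m * ([:1, -1:] * pderiv ([:1, -1:] ^ i))"
      by (simp add: m pderiv_mult algebra_simps)
    also have "\<dots> = (of_nat m * [:1, -1:] - of_nat i * [:1, 1:]) * ?y"
      unfolding p q by (simp add: m algebra_simps)
    also have "of_nat m * [:1, -1:] - of_nat i * [:1, 1:] = [:?l, - of_nat d:]"
      by (simp add: m of_nat_poly)
    finally show ?thesis .
  qed
  have rec: "of_nat (Suc (Suc k)) * coeff ?y (Suc (Suc k)) - of_nat k * coeff ?y k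
      = ?l * coeff ?y (Suc k) - of_nat d * coeff ?y k" for k
  proof -
    have "coeff ([:1, 0, -1:] * pderiv ?y) (Suc k)
        = of_nat (Suc (Suc k)) * coeff ?y (Suc (Suc k)) - of_nat k * coeff ?y k"
      by (cases k) (simp_all add: coeff_pderiv)
    moreover have "coeff ([:?l, - of_nat d:] * ?y) (Suc k)
        = ?l * coeff ?y (Suc k) - of_nat d * coeff ?y k"
      by simp
    ultimately show ?thesis by (simp only: ode)
  qed
  have y0: "coeff ?y 0 = 1"
    by (simp add: poly_0_coeff_0[symmetric])
  show ?thesis
  proof (induction k rule: induct_nat_012)
    case 0
    show ?case using y0 by simp
  next
    case 1
    have "coeff ([:1, 0, -1:] * pderiv ?y) 0 = coeff ([:?l, - of_nat d:] * ?y) 0"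
      by (simp only: ode)
    then show ?case using y0 by (simp add: coeff_pderiv)
  next
    case (ge2 k)
    have w: "(kac_weight d (Suc k) :: 'a) * coeff ?y k
        = - of_nat (Suc k) * (of_nat d - of_nat k) * coeff ?y k"
    proof (cases "k \<le> d")
      case True
      then obtain m where "d = k + m" using le_Suc_ex by blast
      then show ?thesis by (simp add: kac_weight_def algebra_simps)
    next
      case False
      then have "coeff ?y k = 0" using deg by (intro coeff_eq_0) simp
      then show ?thesis by simp
    qed
    have "poly (cont (kac_weight d) (Suc (Suc k))) ?l
        = fact (Suc k) * (?l * coeff ?y (Suc k)) + fact k * (kac_weight d (Suc k) * coeff ?y k)"
      using ge2 by (simp add: algebra_simps)
    also have "\<dots> = fact (Suc k) * (?l * coeff ?y (Suc k) - (of_nat d - of_nat k) * coeff ?y k)"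
      unfolding w by (simp add: algebra_simps)
    also have "?l * coeff ?y (Suc k) - (of_nat d - of_nat k) * coeff ?y k
        = of_nat (Suc (Suc k)) * coeff ?y (Suc (Suc k))"
    proof -
      have "L - (D - K) * c = A" if "A - K * c = L - D * c" for A K L D c :: 'a
        using that by (simp add: algebra_simps)
      from this[OF rec[of k]] show ?thesis .
    qed
    also have "fact (Suc k) * (of_nat (Suc (Suc k)) * coeff ?y (Suc (Suc k)))
        = fact (Suc (Suc k)) * coeff ?y (Suc (Suc k))"
      by (simp only: fact_Suc[of "Suc k"] mult_ac)
    finally show ?case .
  qed
qed

text \<open>
  The generating polynomial has degree \<open>d\<close>, so its coefficient of \<open>z^(d+1)\<close> vanishes.
\<close>

corollary cont_kac_root:
  fixes d i :: nat
  assumes "i \<le> d"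
  shows "poly (cont (kac_weight d) (Suc d)) (of_nat d - 2 * of_nat i :: 'a::{idom,ring_char_0}) = 0"
proof -
  have "coeff ([:1, 1 :: 'a:] ^ (d - i) * [:1, -1:] ^ i) (Suc d) = 0"
    using degree_kac_series[OF assms, where ?'a = 'a] by (intro coeff_eq_0) simp
  then show ?thesis
    by (simp only: poly_cont_kac[OF assms] mult_zero_right)
qed

lemma prod_linear_eq_sum_elem_sym:
  fixes y c :: "'a::comm_ring_1"
  assumes "finite S"
  shows "(\<Prod>s\<in>S. y + c * of_nat s)
     = (\<Sum>j\<le>card S. c ^ j * of_nat (elem_sym j S) * y ^ (card S - j))"
proof -
  have fin: "finite (Pow S)" using assms by simp
  have "(\<Prod>s\<in>S. y + c * of_nat s) = (\<Prod>s\<in>S. c * of_nat s + y)"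
    by (simp add: add.commute)
  also have "\<dots> = (\<Sum>X\<in>Pow S. c ^ card X * of_nat (\<Prod>x\<in>X. x) * y ^ (card S - card X))"
    unfolding prod_add[OF assms]
    by (intro sum.cong refl)
       (use assms in \<open>auto simp: prod.distrib card_Diff_subset finite_subset\<close>)
  also have "\<dots> = (\<Sum>j\<le>card S. \<Sum>X | X \<in> Pow S \<and> card X = j.
      c ^ card X * of_nat (\<Prod>x\<in>X. x) * y ^ (card S - card X))"
    by (rule sum.group[symmetric]) (use assms fin in \<open>auto intro: card_mono\<close>)
  also have "\<dots> = (\<Sum>j\<le>card S. c ^ j * of_nat (elem_sym j S) * y ^ (card S - j))"
    by (intro sum.cong refl) (simp add: elem_sym_def sum_distrib_left sum_distrib_right)
  finally show ?thesis .
qed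

lemma S_A_eq_image: "S_A d = (\<lambda>i. 4 * (d - 2 * i)\<^sup>2) ` {..<(d + 1) div 2}"
proof (intro equalityI subsetI)
  fix s assume "s \<in> S_A d"
  then obtain k where k: "s = 4 * k\<^sup>2" "1 \<le> k" "k \<le> d" "k mod 2 = d mod 2"
    by (auto simp: S_A_def)
  have "\<exists>i. d = k + 2 * i" using k(3,4) by presburger
  then obtain i where i: "d = k + 2 * i" ..
  then have "i < (d + 1) div 2" using k(2) by linarith
  moreover have "s = 4 * (d - 2 * i)\<^sup>2" using i k(1) by simp
  ultimately show "s \<in> (\<lambda>i. 4 * (d - 2 * i)\<^sup>2) ` {..<(d + 1) div 2}" by blast
next
  fix s assume "s \<in> (\<lambda>i. 4 * (d - 2 * i)\<^sup>2) ` {..<(d + 1) div 2}"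
  then obtain i where i: "i < (d + 1) div 2" "s = 4 * (d - 2 * i)\<^sup>2" by auto
  then have "2 * i < d" by linarith
  then obtain k where "d = 2 * i + k" "1 \<le> k"
    by (metis less_imp_add_positive Suc_leI One_nat_def)
  then show "s \<in> S_A d" using i(2) by (auto simp: S_A_def intro!: exI[of _ k])
qed

lemma card_S_A: "card (S_A d) = (d + 1) div 2"
proof -
  have "inj_on (\<lambda>i. 4 * (d - 2 * i)\<^sup>2) {..<(d + 1) div 2}"
    by (rule inj_onI) auto
  then show ?thesis by (simp add: S_A_eq_image card_image)
qed

text \<open>
  The Sylvester-Kac evaluation: both sides are monic of degree \<open>d + 1\<close> and vanish at the \<open>d + 1\<close>
  points \<open>d - 2i\<close>. Opposite nonzero roots \<open>k\<close> and \<open>-k\<close> share the factor \<open>X^2 - s/4\<close> with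
  \<open>s = 4 k^2\<close>; the leading monomial is \<open>X\<close> exactly when \<open>d\<close> is even and 0 is a root.
\<close>

lemma cont_kac_eq_prod:
  "cont (kac_weight d) (d + 1)
     = monom 1 (d + 1 - 2 * ((d + 1) div 2)) * (\<Prod>s\<in>S_A d. monom 1 2 + [:- 1 / 4 :: rat:] * of_nat s)"
    (is "?C = ?T")
proof (rule poly_eqI_degree_lead_coeff)
  let ?r = "(d + 1) div 2" and ?A = "(\<lambda>i. of_nat d - 2 * of_nat i :: rat) ` {..d}"
  define g :: "nat \<Rightarrow> rat poly" where "g s = monom 1 2 + [:- 1 / 4:] * of_nat s" for s
  have g: "g s = [:- of_nat s / 4, 0, 1:]" for s
    by (simp add: g_def of_nat_poly monom_altdef numeral_2_eq_2)
  have "degree (prod g (S_A d)) = (\<Sum>s\<in>S_A d. degree (g s))"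
    by (rule degree_prod_eq_sum_degree) (simp add: g)
  then have deg_prod: "degree (prod g (S_A d)) = 2 * ?r"
    by (simp add: g card_S_A)
  have lead: "lead_coeff (prod g (S_A d)) = 1"
    by (simp add: lead_coeff_prod g)
  have T: "?T = monom 1 (d + 1 - 2 * ?r) * prod g (S_A d)"
    by (simp add: g_def)
  have nz: "prod g (S_A d) \<noteq> 0" using lead by auto
  have "degree ?T = degree (monom (1 :: rat) (d + 1 - 2 * ?r)) + degree (prod g (S_A d))"
    unfolding T by (rule degree_mult_eq) (use nz in auto)
  also have "\<dots> = d + 1"
    by (simp only: deg_prod degree_monom_eq one_neq_zero not_False_eq_True)
  finally have deg_T: "degree ?T = d + 1" .
  show "degree ?T \<le> d + 1" using deg_T by simp
  show "degree ?C \<le> d + 1" by (rule cont_monic[THEN conjunct1])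
  have "lead_coeff ?T = 1"
    unfolding T lead_coeff_mult lead by (simp only: lead_coeff_monom mult_1_right)
  then have "coeff ?T (d + 1) = 1" by (simp only: deg_T)
  then show "coeff ?C (d + 1) = coeff ?T (d + 1)"
    using cont_monic[of "kac_weight d :: nat \<Rightarrow> rat" "d + 1"] by simp
  have "inj_on (\<lambda>i. of_nat d - 2 * of_nat i :: rat) {..d}"
    by (auto intro!: inj_onI)
  then show "d + 1 \<le> card ?A" by (simp add: card_image)
  fix z assume "z \<in> ?A"
  then obtain i where i: "i \<le> d" "z = of_nat d - 2 * of_nat i" by auto
  have "poly ?T z = 0"
  proof (cases "d = 2 * i")
    case True
    then show ?thesis by (simp add: i(2) poly_monom)
  next
    case False
    obtain k where k: "d = 2 * i + k \<or> 2 * i = d + k"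
      by (metis le_Suc_ex nat_le_linear)
    have "even (d + k)"
      using k by (elim disjE) (simp, metis dvd_triv_left)
    then have k': "k mod 2 = d mod 2" by presburger
    have "k \<noteq> 0" using k False by auto
    moreover have "k \<le> d" using k i(1) by (elim disjE) linarith+
    ultimately have "4 * k\<^sup>2 \<in> S_A d" using k' by (auto simp: S_A_def)
    have "rat_of_nat d = rat_of_nat (2 * i + k) \<or> rat_of_nat (2 * i) = rat_of_nat (d + k)"
      using k by metis
    then have "z = of_nat k \<or> z = - of_nat k"
      unfolding i(2) by auto
    then have "z\<^sup>2 = of_nat k ^ 2" by auto
    with \<open>4 * k\<^sup>2 \<in> S_A d\<close> have "poly (prod g (S_A d)) z = 0"
      by (simp add: poly_prod g prod_zero_iff finite_S_A)
         (intro bexI[of _ "4 * k\<^sup>2"], auto simp: power2_eq_square)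
    then show ?thesis by (simp only: T poly_mult mult_zero_right)
  qed
  then show "poly ?C z = poly ?T z"
    using cont_kac_root[OF i(1), where ?'a = rat] i(2) by simp
qed

lemma coeff_cont_kac:
  assumes "j \<le> (d + 1) div 2"
  shows "coeff (cont (kac_weight d) (d + 1)) (d + 1 - 2 * j)
     = (- 1 / 4 :: rat) ^ j * of_nat (elem_sym j (S_A d))"
proof -
  let ?r = "(d + 1) div 2"
  have "cont (kac_weight d) (d + 1)
      = monom 1 (d + 1 - 2 * ?r)
        * (\<Sum>i\<le>?r. [:- 1 / 4 :: rat:] ^ i * of_nat (elem_sym i (S_A d)) * monom 1 2 ^ (?r - i))"
    unfolding cont_kac_eq_prod prod_linear_eq_sum_elem_sym[OF finite_S_A] card_S_A ..
  also have "\<dots> = (\<Sum>i\<le>?r. monom ((- 1 / 4) ^ i * of_nat (elem_sym i (S_A d))) (d + 1 - 2 * i))"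
    unfolding sum_distrib_left
  proof (intro sum.cong refl)
    fix i assume "i \<in> {..?r}"
    then have "d + 1 - 2 * ?r + 2 * (?r - i) = d + 1 - 2 * i" by auto
    then show "monom 1 (d + 1 - 2 * ?r)
        * ([:- 1 / 4 :: rat:] ^ i * of_nat (elem_sym i (S_A d)) * monom 1 2 ^ (?r - i))
      = monom ((- 1 / 4) ^ i * of_nat (elem_sym i (S_A d))) (d + 1 - 2 * i)"
      by (simp add: poly_const_pow of_nat_poly monom_power mult_monom smult_monom)
  qed
  finally have "coeff (cont (kac_weight d) (d + 1)) (d + 1 - 2 * j)
      = (\<Sum>i\<le>?r. if d + 1 - 2 * i = d + 1 - 2 * j
          then (- 1 / 4 :: rat) ^ i * of_nat (elem_sym i (S_A d)) else 0)"
    by (simp only: coeff_sum coeff_monom)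
  also have "\<dots> = (\<Sum>i\<le>?r. if i = j then (- 1 / 4 :: rat) ^ i * of_nat (elem_sym i (S_A d)) else 0)"
    using assms by (intro sum.cong refl if_cong) auto
  finally show ?thesis using assms by simp
qed

text \<open>Positivity is what makes the degrees in the theorem exact.\<close>

lemma elem_sym_pos:
  fixes S :: "nat set"
  assumes "finite S" "0 \<notin> S" "j \<le> card S"
  shows "elem_sym j S > 0"
proof -
  obtain X where X: "X \<subseteq> S" "card X = j"
    using obtain_subset_with_card_n[OF assms(3)] by metis
  have "(\<Prod>x\<in>X. x) > 0"
    using X(1) assms(2) by (intro prod_pos) (metis gr0I subsetD)
  also have "(\<Prod>x\<in>X. x) \<le> elem_sym j S"
    unfolding elem_sym_def
    by (rule member_le_sum) (use X assms in auto)
  finally show ?thesis .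
qed

lemma elem_sym_S_A_pos: "j \<le> (d + 1) div 2 \<Longrightarrow> elem_sym j (S_A d) > 0"
  by (rule elem_sym_pos[OF finite_S_A]) (auto simp: card_S_A, auto simp: S_A_def)

section \<open>The coefficient polynomials of the recurrence\<close>

text \<open>
  The polynomial \<open>Q_(r-j)\<close> of the theorem. For \<open>j > 0\<close> the factor in front of \<open>P_j\<close> is
  \<open>(2x+1) (2x+2) ... (2x+2j) / (x+j)\<close>: the quotient of factorials that turns the coefficients of
  \<open>f^d\<close> into \<open>A_n\<close>, divided by \<open>n = x + j\<close>. For \<open>j = 0\<close> the division by \<open>n\<close> has to be carried
  out on \<open>P_0 = x^(d+1)\<close> itself.
\<close>

definition rec_poly :: "nat \<Rightarrow> nat \<Rightarrow> rat poly" where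
  "rec_poly d j = (if j = 0 then monom 1 d
     else (\<Prod>i=1..j. [:2 * of_nat i - 1, 2:]) * (\<Prod>i=1..j - 1. [:of_nat i, 1:])
            * smult (2 ^ j) (op_cont (kac_weight d) (d + 1) j))"

lemma poly_rec_poly:
  assumes "j > 0"
  shows "poly (rec_poly d j) x = 2 ^ j * (\<Prod>i=1..j. 2 * x + (2 * of_nat i - 1))
     * (\<Prod>i=1..j - 1. x + of_nat i) * poly (op_cont (kac_weight d) (d + 1) j) x"
  using assms by (simp add: rec_poly_def poly_prod add.commute mult.commute)

lemma fact_double_shift:
  "fact (2 * (m + j)) = (2 ^ j * (\<Prod>i=1..j. 2 * of_nat m + (2 * of_nat i - 1))
     * (\<Prod>i=1..j. of_nat m + of_nat i) * fact (2 * m) :: 'a::{comm_ring_1,ring_char_0})"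
proof (induction j)
  case (Suc j)
  have "fact (2 * (m + Suc j)) = (of_nat (2 * (m + j) + 2) * of_nat (2 * (m + j) + 1)
      * fact (2 * (m + j)) :: 'a)"
    by (simp add: algebra_simps)
  then show ?case unfolding Suc by (simp add: algebra_simps)
qed simp

lemma rec_poly_fact:
  "of_nat (m + j) * poly (rec_poly d j) (of_nat m) * fact (2 * m)
     = fact (2 * (m + j)) * poly (op_cont (kac_weight d) (d + 1) j) (of_nat m)"
proof (cases j)
  case 0
  then show ?thesis by (simp add: rec_poly_def op_cont_0 poly_monom)
next
  case (Suc i)
  then show ?thesis
    unfolding fact_double_shift by (simp add: poly_rec_poly algebra_simps)
qed

text \<open>
  This contains both the recurrence (\<open>n \<ge> r\<close>) and the initial conditions (\<open>n < r\<close>). After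
  multiplication by \<open>n\<close> it is the coefficient of \<open>t^n\<close> in \<open>L_(d+1) f^d = 0\<close>. For \<open>n = 0\<close> the
  cancelled factor is zero, and the claim holds because \<open>x^d\<close> vanishes at 0.
\<close>

lemma rec_poly_recurrence:
  assumes "d \<ge> 1"
  shows "(\<Sum>j\<le>n. poly (rec_poly d j) (of_nat (n - j)) * A_seq d (n - j)) = 0"
proof (cases "n = 0")
  case True
  then show ?thesis using assms by (simp add: rec_poly_def poly_monom)
next
  case False
  have "of_nat n * (\<Sum>j\<le>n. poly (rec_poly d j) (of_nat (n - j)) * A_seq d (n - j))
      = (\<Sum>j\<le>n. fact (2 * n) * (poly (op_cont (kac_weight d) (d + 1) j) (of_nat (n - j))
          * fps_nth (bessel_fps ^ d) (n - j)))"
    unfolding sum_distrib_left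
  proof (intro sum.cong refl)
    fix j assume "j \<in> {..n}"
    then have "n - j + j = n" by simp
    then show "of_nat n * (poly (rec_poly d j) (of_nat (n - j)) * A_seq d (n - j))
        = fact (2 * n) * (poly (op_cont (kac_weight d) (d + 1) j) (of_nat (n - j))
            * fps_nth (bessel_fps ^ d) (n - j))"
      using rec_poly_fact[of "n - j" j d] by (simp add: A_seq_eq_bessel_power[OF assms])
  qed
  also have "\<dots> = 0"
    using op_cont_annihilates_power[OF theta_theta_bessel, of d n]
    by (simp flip: sum_distrib_left)
  finally show ?thesis using False by simp
qed

lemma rec_poly_eq_0: "(d + 1) div 2 < j \<Longrightarrow> rec_poly d j = 0"
proof -
  assume "(d + 1) div 2 < j"
  then have "d + 1 < 2 * j" "j \<noteq> 0" by auto
  then show ?thesis unfolding rec_poly_def using op_cont_eq_0[of "d + 1" j] by simp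
qed

lemma op_cont_kac_degree_lead:
  assumes "j \<le> (d + 1) div 2"
  shows "degree (op_cont (kac_weight d :: nat \<Rightarrow> rat) (d + 1) j) = d + 1 - 2 * j" (is ?deg)
    and "lead_coeff (op_cont (kac_weight d) (d + 1) j)
      = (- 1 / 4 :: rat) ^ j * of_nat (elem_sym j (S_A d))" (is ?lead)
proof -
  let ?p = "op_cont (kac_weight d :: nat \<Rightarrow> rat) (d + 1) j"
  have "2 * j \<le> d + 1" using assms by linarith
  then have top: "coeff ?p (d + 1 - 2 * j) = (- 1 / 4) ^ j * of_nat (elem_sym j (S_A d))"
    by (simp only: coeff_op_cont_top coeff_cont_kac[OF assms])
  then have "coeff ?p (d + 1 - 2 * j) \<noteq> 0" using elem_sym_S_A_pos[OF assms] by simp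
  then show deg: ?deg
    using degree_op_cont by (intro antisym le_degree)
  show ?lead by (simp only: deg top)
qed

lemma rec_poly_degree_lead:
  assumes "j \<le> (d + 1) div 2"
  shows "degree (rec_poly d j) = d"
    and "lead_coeff (rec_poly d j) = (- 1) ^ j * of_nat (elem_sym j (S_A d))"
proof -
  let ?p = "op_cont (kac_weight d :: nat \<Rightarrow> rat) (d + 1) j"
  let ?a = "\<Prod>i=1..j. [:2 * of_nat i - 1, 2 :: rat:]" and ?b = "\<Prod>i=1..j - 1. [:of_nat i, 1 :: rat:]"
  have a: "degree ?a = j" "?a \<noteq> 0" and b: "degree ?b = j - 1" "?b \<noteq> 0"
    by (simp_all add: degree_prod_eq_sum_degree)
  have lead: "lead_coeff ?a = 2 ^ j" "lead_coeff ?b = 1"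
    unfolding lead_coeff_prod by simp_all
  note p = op_cont_kac_degree_lead[OF assms]
  have "lead_coeff ?p \<noteq> 0" unfolding p(2) using elem_sym_S_A_pos[OF assms] by simp
  then have p0: "?p \<noteq> 0" by auto
  show "degree (rec_poly d j) = d"
  proof (cases "j = 0")
    case False
    then have "degree (rec_poly d j) = degree ?a + degree ?b + degree ?p"
      using a(2) b(2) p0 by (simp add: rec_poly_def degree_mult_eq del: prod_zero_iff)
    also have "\<dots> = d" using False assms unfolding a b p by linarith
    finally show ?thesis .
  qed (simp add: rec_poly_def degree_monom_eq)
  show "lead_coeff (rec_poly d j) = (- 1) ^ j * of_nat (elem_sym j (S_A d))"
  proof (cases "j = 0")
    case False
    then have "lead_coeff (rec_poly d j) = 2 ^ j * (2 ^ j * lead_coeff ?p)"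
      by (simp only: rec_poly_def if_False lead_coeff_mult lead_coeff_smult lead mult_1_right)
    also have "\<dots> = (2 * 2 * (- 1 / 4)) ^ j * of_nat (elem_sym j (S_A d))"
      unfolding p(2) power_mult_distrib by (simp only: mult.assoc)
    finally show ?thesis by simp
  next
    case True
    then show ?thesis
      by (simp add: rec_poly_def degree_monom_eq elem_sym_0 finite_S_A)
  qed
qed

text \<open>
  The weights \<open>i (d + 1 - i)\<close> are a palindrome, so reversing the continuant changes nothing.
\<close>

lemma op_cont_kac_reflect:
  "poly (op_cont (kac_weight d) (d + 1) j) (- x - of_nat j)
     = (- 1) ^ (d + 1) * poly (op_cont (kac_weight d) (d + 1) j) x"
proof -
  have "kac_weight d (d + 1 - i) = (kac_weight d i :: 'a)" for i
    by (cases "i \<le> d + 1") (simp_all add: kac_weight_def mult.commute)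
  then show ?thesis
    using op_cont_reverse[of "kac_weight d" "d + 1" j x] by simp
qed

text \<open>
  The reflection permutes the factors of each of the two products up to sign; the signs
  \<open>(-1)^j (-1)^(j-1) (-1)^(d+1)\<close> combine to \<open>(-1)^d\<close>.
\<close>

lemma rec_poly_reflect:
  "poly (rec_poly d j) (- x - of_nat j) = (- 1) ^ d * poly (rec_poly d j) x"
proof (cases j)
  case 0
  then show ?thesis by (simp add: rec_poly_def poly_monom power_minus[of x])
next
  case (Suc i)
  then have j: "j > 0" by simp
  have "(\<Prod>l=1..j. 2 * (- x - of_nat j) + (2 * of_nat l - 1))
      = (\<Prod>l=1..j. - (2 * x + (2 * of_nat l - 1)))"
    by (rule prod.reindex_bij_witness[of _ "\<lambda>l. j + 1 - l" "\<lambda>l. j + 1 - l"])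
       (auto simp: of_nat_diff algebra_simps)
  then have odd_part: "(\<Prod>l=1..j. 2 * (- x - of_nat j) + (2 * of_nat l - 1))
      = (- 1) ^ j * (\<Prod>l=1..j. 2 * x + (2 * of_nat l - 1))"
    by (simp only: prod_uminus card_atLeastAtMost diff_Suc_1)
  have "(\<Prod>l=1..j - 1. - x - of_nat j + of_nat l) = (\<Prod>l=1..j - 1. - (x + of_nat l))"
    by (rule prod.reindex_bij_witness[of _ "\<lambda>l. j - l" "\<lambda>l. j - l"])
       (auto simp: of_nat_diff algebra_simps)
  then have even_part: "(\<Prod>l=1..j - 1. - x - of_nat j + of_nat l)
      = (- 1) ^ (j - 1) * (\<Prod>l=1..j - 1. x + of_nat l)"
    by (simp only: prod_uminus card_atLeastAtMost diff_Suc_1)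
  have "poly (rec_poly d j) (- x - of_nat j)
      = ((- 1) ^ j * (- 1) ^ (j - 1) * (- 1) ^ (d + 1)) * poly (rec_poly d j) x"
    unfolding poly_rec_poly[OF j] odd_part even_part op_cont_kac_reflect by (simp only: mult_ac)
  also have "(- 1) ^ j * (- 1) ^ (j - 1) * (- 1) ^ (d + 1) = ((- 1) ^ d :: rat)"
    by (simp add: Suc flip: power_mult_distrib)
  finally show ?thesis .
qed

text \<open>
  At \<open>j = r\<close> the polynomial \<open>P_r\<close> has degree \<open>d + 1 - 2r\<close>: it is constant for odd \<open>d\<close>, and for
  even \<open>d\<close> it is linear and odd about \<open>-r/2\<close>.
\<close>

lemma poly_rec_poly_last:
  assumes "d \<ge> 1"
  defines "r \<equiv> (d + 1) div 2"
  shows "poly (rec_poly d r) x = (- 1) ^ r * of_nat (elem_sym r (S_A d))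
     * (if even d then x + of_nat r / 2 else 1)
     * (\<Prod>j=1..r. x + of_nat j - 1 / 2) * (\<Prod>j=1..r - 1. x + of_nat j)"
proof -
  let ?p = "op_cont (kac_weight d :: nat \<Rightarrow> rat) (d + 1) r"
  define a where "a = lead_coeff ?p"
  have deg: "degree ?p = d + 1 - 2 * r"
    and a: "a = (- 1 / 4) ^ r * of_nat (elem_sym r (S_A d))"
    unfolding a_def using op_cont_kac_degree_lead[of r d] by (simp_all add: r_def)
  have p: "poly ?p x = a * (if even d then x + of_nat r / 2 else 1)"
  proof (cases "even d")
    case True
    then have deg1: "degree ?p = 1" using deg unfolding r_def by presburger
    then obtain b c where bc: "?p = [:b, c:]" "c \<noteq> 0" by (metis degree1_coeffs)
    then have b: "?p = [:b, a:]" by (simp only: a_def) simp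
    \<comment> \<open>The reflection at \<open>x = 0\<close> determines the constant term from the leading one.\<close>
    have "poly ?p (- 0 - of_nat r) = - poly ?p 0"
      using True by (simp only: op_cont_kac_reflect) simp
    then have "b = a * of_nat r / 2" unfolding b by (simp add: algebra_simps)
    then show ?thesis using True unfolding b by (simp add: algebra_simps)
  next
    case False
    then have deg0: "degree ?p = 0" using deg unfolding r_def by presburger
    then show ?thesis using False by (metis a_def degree_0_id mult_1_right poly_const_conv)
  qed
  have "r > 0" using assms by simp
  then have "poly (rec_poly d r) x = 2 ^ r * (\<Prod>j=1..r. 2 * x + (2 * of_nat j - 1))
      * (\<Prod>j=1..r - 1. x + of_nat j) * (a * (if even d then x + of_nat r / 2 else 1))"
    by (simp only: poly_rec_poly p)
  also have "(\<Prod>j=1..r. 2 * x + (2 * of_nat j - 1)) = 2 ^ r * (\<Prod>j=1..r. x + of_nat j - 1 / 2)"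
  proof -
    have "(\<Prod>j=1..r. 2 * x + (2 * of_nat j - 1)) = (\<Prod>j=1..r. 2 * (x + of_nat j - 1 / 2))"
      by (intro prod.cong refl) (simp add: algebra_simps)
    then show ?thesis by (simp only: prod.distrib prod_constant card_atLeastAtMost diff_Suc_1)
  qed
  also have "2 ^ r * (2 ^ r * (\<Prod>j=1..r. x + of_nat j - 1 / 2)) * (\<Prod>j=1..r - 1. x + of_nat j)
        * (a * (if even d then x + of_nat r / 2 else 1))
      = (2 ^ r * 2 ^ r * (- 1 / 4) ^ r) * of_nat (elem_sym r (S_A d))
        * (if even d then x + of_nat r / 2 else 1)
        * (\<Prod>j=1..r. x + of_nat j - 1 / 2) * (\<Prod>j=1..r - 1. x + of_nat j)"
    unfolding a by (simp only: mult_ac)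
  also have "2 ^ r * 2 ^ r * (- 1 / 4) ^ r = (- 1 :: rat) ^ r"
    by (simp flip: power_mult_distrib)
  finally show ?thesis .
qed

lemma sum_Suc_powers:
  fixes f :: "nat \<Rightarrow> 'a::comm_ring_1"
  shows "(\<Sum>i<Suc d. f i * y ^ (d - i)) = y * (\<Sum>i<d. f i * y ^ (d - 1 - i)) + f d"
proof -
  have "y ^ (d - i) = y * y ^ (d - 1 - i)" if "i < d" for i
  proof -
    have "d - i = Suc (d - 1 - i)" using that by simp
    then show ?thesis by (simp only: power_Suc)
  qed
  then show ?thesis by (simp add: sum_distrib_left mult_ac)
qed

text \<open>
  Raising \<open>d\<close> by one multiplies the earlier terms by \<open>x + 1\<close> and adds a last term. In the
  quadratic weight \<open>(i+1) (d-i)\<close> the step \<open>d + 1 - i = (d - i) + 1\<close> splits off a sum with the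
  linear weight, so the linear case is evaluated first.
\<close>

lemma sum_linear_weight:
  fixes x :: "'a::comm_ring_1"
  shows "(\<Sum>i<d. of_nat (Suc i) * x ^ i * (x + 1) ^ (d - 1 - i))
     = (x + 1) ^ (d + 1) - of_nat (d + 1) * x ^ d * (x + 1) + of_nat d * x ^ (d + 1)"
proof (induction d)
  case (Suc d)
  have "(\<Sum>i<Suc d. of_nat (Suc i) * x ^ i * (x + 1) ^ (Suc d - 1 - i))
      = (x + 1) * (\<Sum>i<d. of_nat (Suc i) * x ^ i * (x + 1) ^ (d - 1 - i))
        + of_nat (Suc d) * x ^ d"
    using sum_Suc_powers[of "\<lambda>i. of_nat (Suc i) * x ^ i" "x + 1" d] by simp
  then show ?case unfolding Suc by (simp add: algebra_simps)
qed simp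

lemma sum_kac_weight:
  fixes x :: "'a::comm_ring_1"
  shows "(\<Sum>i<d. of_nat (Suc i * (d - i)) * x ^ i * (x + 1) ^ (d - 1 - i))
     = (x + 1) ^ (d + 1) * (of_nat d - 2 * x) + x ^ (d + 1) * (of_nat d + 2 + 2 * x)"
proof (induction d)
  case (Suc d)
  have "(\<Sum>i<Suc d. of_nat (Suc i * (Suc d - i)) * x ^ i * (x + 1) ^ (Suc d - 1 - i))
      = (\<Sum>i<Suc d. of_nat (Suc i * (d - i)) * x ^ i * (x + 1) ^ (d - i))
        + (\<Sum>i<Suc d. of_nat (Suc i) * x ^ i * (x + 1) ^ (Suc d - 1 - i))"
    unfolding sum.distrib[symmetric]
    by (intro sum.cong refl) (auto simp: Suc_diff_le algebra_simps)
  also have "(\<Sum>i<Suc d. of_nat (Suc i * (d - i)) * x ^ i * (x + 1) ^ (d - i))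
      = (x + 1) * (\<Sum>i<d. of_nat (Suc i * (d - i)) * x ^ i * (x + 1) ^ (d - 1 - i))"
    using sum_Suc_powers[of "\<lambda>i. of_nat (Suc i * (d - i)) * x ^ i" "x + 1" d] by simp
  finally show ?case
    unfolding Suc sum_linear_weight by (simp add: algebra_simps)
qed (simp add: algebra_simps)

text \<open>
  Extended to all \<open>j \<le> d + 2\<close>, the sum is a combination of the binomial theorem and its first
  moment, which gives the first term of the closed form. The terms \<open>j = d + 1\<close> and \<open>j = d + 2\<close>
  give the second one, and the term \<open>j = d\<close> vanishes.
\<close>

lemma sum_binomial_weight:
  fixes x :: "'a::comm_ring_1"
  assumes "d \<ge> 1"
  shows "(\<Sum>j=0..d - 1. of_nat ((d - j) * ((d + 2) choose j)) * x ^ j)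
     = (x + 1) ^ (d + 1) * (of_nat d - 2 * x) + x ^ (d + 1) * (of_nat d + 2 + 2 * x)"
proof -
  let ?b = "\<lambda>j. of_nat ((d + 2) choose j) * x ^ j"
  have absorb: "of_nat (Suc j) * ?b (Suc j)
      = of_nat (d + 2) * x * (of_nat ((d + 1) choose j) * x ^ j)" for j
  proof -
    have "of_nat (Suc j) * ?b (Suc j) = of_nat (Suc j * (Suc (d + 1) choose Suc j)) * (x * x ^ j)"
      by (simp only: of_nat_mult power_Suc mult.assoc) (simp del: binomial_Suc_Suc)
    also have "\<dots> = of_nat (Suc (d + 1) * ((d + 1) choose j)) * (x * x ^ j)"
      by (simp only: Suc_times_binomial)
    also have "\<dots> = of_nat (d + 2) * x * (of_nat ((d + 1) choose j) * x ^ j)"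
      by (simp add: algebra_simps)
    finally show ?thesis .
  qed
  have "(\<Sum>j\<le>d + 2. of_nat j * ?b j) = (\<Sum>j\<le>d + 1. of_nat (Suc j) * ?b (Suc j))"
    using sum.atMost_Suc_shift[of "\<lambda>j. of_nat j * ?b j" "d + 1"] by simp
  also have "\<dots> = of_nat (d + 2) * x * (x + 1) ^ (d + 1)"
    by (simp only: absorb binomial_ring power_one mult_1_right sum_distrib_left[symmetric])
  finally have moment: "(\<Sum>j\<le>d + 2. of_nat j * ?b j) = of_nat (d + 2) * x * (x + 1) ^ (d + 1)" .
  have "(\<Sum>j\<le>d + 2. (of_nat d - of_nat j) * ?b j)
      = of_nat d * (x + 1) ^ (d + 2) - of_nat (d + 2) * x * (x + 1) ^ (d + 1)"
    unfolding moment[symmetric] by (simp only: left_diff_distrib sum_subtractf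
      sum_distrib_left[symmetric] binomial_ring power_one mult_1_right)
  also have "\<dots> = (x + 1) ^ (d + 1) * (of_nat d - 2 * x)"
    by (simp add: algebra_simps)
  also have "(\<Sum>j\<le>d + 2. (of_nat d - of_nat j) * ?b j)
      = (\<Sum>j\<le>d - 1. (of_nat d - of_nat j) * ?b j) - x ^ (d + 1) * (of_nat d + 2 + 2 * x)"
  proof -
    have split: "(\<Sum>j\<le>d + 2. t j) = (\<Sum>j\<le>d - 1. t j) + t d + t (d + 1) + t (d + 2)"
      for t :: "nat \<Rightarrow> 'a"
      using assms by (cases d) simp_all
    have b1: "?b (d + 1) = of_nat (d + 2) * x ^ (d + 1)"
      using binomial_Suc_n[of "d + 1"] by (simp del: binomial_Suc_Suc binomial_Suc_n)
    have b2: "?b (d + 2) = x ^ (d + 2)" by simp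
    show ?thesis
      unfolding split b1 b2 by (simp add: algebra_simps)
  qed
  finally have "(\<Sum>j\<le>d - 1. (of_nat d - of_nat j) * ?b j)
      = (x + 1) ^ (d + 1) * (of_nat d - 2 * x) + x ^ (d + 1) * (of_nat d + 2 + 2 * x)"
    by (simp only: diff_eq_eq)
  moreover have "(\<Sum>j=0..d - 1. of_nat ((d - j) * ((d + 2) choose j)) * x ^ j)
      = (\<Sum>j\<le>d - 1. (of_nat d - of_nat j) * ?b j)"
    unfolding atLeast0AtMost by (intro sum.cong refl) (auto simp: of_nat_diff mult.assoc)
  ultimately show ?thesis by simp
qed

lemma poly_rec_poly_1:
  "poly (rec_poly d 1) x = - 2 * (2 * x + 1)
     * ((x + 1) ^ (d + 1) * (of_nat d - 2 * x) + x ^ (d + 1) * (of_nat d + 2 + 2 * x))"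
proof -
  define S where "S = (\<Sum>i<d. of_nat (Suc i * (d - i)) * x ^ i * (x + 1) ^ (d - 1 - i))"
  have "poly (op_cont (kac_weight d) (d + 1) 1) x
      = - (\<Sum>i<d. of_nat (Suc i * (d - i)) * x ^ i * (x + 1) ^ (d - 1 - i))"
  proof -
    have "kac_weight d (Suc i) = (- of_nat (Suc i * (d - i)) :: rat)" for i
      by (simp add: kac_weight_def)
    then show ?thesis
      using poly_op_cont_1[of "kac_weight d" d x]
      by (simp only: Suc_eq_plus1 sum_negf mult_minus_left)
  qed
  then have "poly (rec_poly d 1) x = - 2 * (2 * x + 1) * S"
    unfolding S_def[symmetric] poly_rec_poly[OF zero_less_one] by (simp add: algebra_simps)
  then show ?thesis by (simp only: S_def sum_kac_weight)
qed

theorem proposition4: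
  fixes d r :: nat
  assumes "d \<ge> 1" and "r = (d + 1) div 2"
  shows "\<exists>Q :: nat \<Rightarrow> rat poly.
      (\<forall>n. (\<Sum>k=0..r. poly (Q k) (of_nat (n + k)) * A_seq d (n + k)) = 0)
    \<and> (\<forall>m<r. (\<Sum>k=0..m. poly (Q (r - m + k)) (of_nat k) * A_seq d k) = 0)
    \<and> (\<forall>k\<le>r. degree (Q k) = d)
    \<and> (\<forall>k\<le>r. \<forall>x. poly (Q k) (- x - of_nat r + of_nat k) = (- 1) ^ d * poly (Q k) x)
    \<and> (\<forall>k\<le>r. lead_coeff (Q k) = (- 1) ^ (r - k) * of_nat (elem_sym (r - k) (S_A d)))
    \<and> (\<forall>x. poly (Q r) x = x ^ d)
    \<and> (\<forall>k<r. (\<Prod>j=1..r - k. [:2 * of_nat j - 1, 2:]) * (\<Prod>j=1..r - k - 1. [:of_nat j, 1:]) dvd Q k)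
    \<and> (odd d \<longrightarrow> (\<forall>x. poly (Q 0) x =
          (- 1) ^ r * of_nat (elem_sym r (S_A d))
            * (\<Prod>j=1..r. x + of_nat j - 1 / 2) * (\<Prod>j=1..r - 1. x + of_nat j)))
    \<and> (even d \<longrightarrow> (\<forall>x. poly (Q 0) x =
          (- 1) ^ r * of_nat (elem_sym r (S_A d)) * (x + of_nat r / 2)
            * (\<Prod>j=1..r. x + of_nat j - 1 / 2) * (\<Prod>j=1..r - 1. x + of_nat j)))
    \<and> (\<forall>x. poly (Q (r - 1)) x =
          - 2 * (2 * x + 1) * (\<Sum>j=0..d - 1. of_nat ((d - j) * ((d + 2) choose j)) * x ^ j))
    \<and> (\<forall>x. poly (Q (r - 1)) x =
          - 2 * (2 * x + 1) * ((x + 1) ^ (d + 1) * (of_nat d - 2 * x) + x ^ (d + 1) * (of_nat d + 2 + 2 * x)))"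
proof -
  define Q where "Q k = rec_poly d (r - k)" for k
  have r: "r \<ge> 1" using assms by simp
  have recurrence: "(\<Sum>k=0..r. poly (Q k) (of_nat (n + k)) * A_seq d (n + k)) = 0" for n
  proof -
    have "(\<Sum>k=0..r. poly (Q k) (of_nat (n + k)) * A_seq d (n + k))
        = (\<Sum>j\<le>r. poly (rec_poly d j) (of_nat (n + r - j)) * A_seq d (n + r - j))"
      by (rule sum.reindex_bij_witness[of _ "\<lambda>j. r - j" "\<lambda>k. r - k"]) (auto simp: Q_def)
    also have "\<dots> = (\<Sum>j\<le>n + r. poly (rec_poly d j) (of_nat (n + r - j)) * A_seq d (n + r - j))"
      by (rule sum.mono_neutral_left) (auto simp: rec_poly_eq_0 assms(2))
    finally show ?thesis by (simp only: rec_poly_recurrence[OF assms(1)])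
  qed
  have init: "(\<Sum>k=0..m. poly (Q (r - m + k)) (of_nat k) * A_seq d k) = 0" if "m < r" for m
  proof -
    have "(\<Sum>k=0..m. poly (Q (r - m + k)) (of_nat k) * A_seq d k)
        = (\<Sum>j\<le>m. poly (rec_poly d j) (of_nat (m - j)) * A_seq d (m - j))"
      by (rule sum.reindex_bij_witness[of _ "\<lambda>j. m - j" "\<lambda>k. m - k"])
         (use that in \<open>auto simp: Q_def\<close>)
    then show ?thesis by (simp only: rec_poly_recurrence[OF assms(1)])
  qed
  have deg: "degree (Q k) = d"
    and lead: "lead_coeff (Q k) = (- 1) ^ (r - k) * of_nat (elem_sym (r - k) (S_A d))" if "k \<le> r" for k
    unfolding Q_def using rec_poly_degree_lead[of "r - k" d] assms(2) by auto
  have reflect: "poly (Q k) (- x - of_nat r + of_nat k) = (- 1) ^ d * poly (Q k) x"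
    if "k \<le> r" for k x
    using rec_poly_reflect[of d "r - k" x] that by (simp add: Q_def of_nat_diff algebra_simps)
  have top_poly: "poly (Q r) x = x ^ d" for x
    by (simp add: Q_def rec_poly_def poly_monom)
  have divides: "(\<Prod>j=1..r - k. [:2 * of_nat j - 1, 2:]) * (\<Prod>j=1..r - k - 1. [:of_nat j, 1:]) dvd Q k"
    if "k < r" for k
  proof -
    have "r - k \<noteq> 0" using that by simp
    then show ?thesis by (simp only: Q_def rec_poly_def if_False dvd_triv_left)
  qed
  have last_poly: "poly (Q 0) x = (- 1) ^ r * of_nat (elem_sym r (S_A d))
      * (if even d then x + of_nat r / 2 else 1)
      * (\<Prod>j=1..r. x + of_nat j - 1 / 2) * (\<Prod>j=1..r - 1. x + of_nat j)" for x
    using poly_rec_poly_last[OF assms(1), of x] by (simp only: Q_def assms(2) diff_zero)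
  have penult: "poly (Q (r - 1)) x = - 2 * (2 * x + 1)
      * ((x + 1) ^ (d + 1) * (of_nat d - 2 * x) + x ^ (d + 1) * (of_nat d + 2 + 2 * x))" for x
    using r poly_rec_poly_1[of d x] by (simp only: Q_def diff_diff_cancel)
  \<comment> \<open>The leading coefficients go through \<open>rule\<close>: as a rewrite rule, the degree formula would first
    replace the index hidden in \<open>lead_coeff\<close>.\<close>
  show ?thesis
    by (intro exI[of _ Q] conjI allI impI)
       (rule deg lead, assumption | simp only: recurrence init reflect top_poly divides last_poly penult
          if_True if_False mult_1_right sum_binomial_weight[OF assms(1)])+
qed

end
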